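(* Let $X$ and $Y$ be Banach spaces, and assume that $Y$ has Property $\mathcal{Q}$. If either (i) there exists a coarse solvent map $X\to Y$, or (ii) there exists a uniformly continuous map $\varphi:B_X\to Y$ such that $\overline{\rho}_\varphi(t)>0$ for some $t\in(0,1)$, then $X$ has Property $\mathcal{Q}$. In particular, if there exists a uniformly continuous almost uncollapsed map $X\to Y$, then $X$ has Property $\mathcal{Q}$.
   Context: All Banach spaces are over the reals; $B_X$ is the closed unit ball of $X$. Let $f:(M,d)\to(N,\partial)$ be a map between metric spaces. Set $\omega_f(t)=\sup\{\partial(f(x),f(y)): d(x,y)\le t\}$ and $\overline{\rho}_f(t)=\inf\{\partial(f(x),f(y)): d(x,y)=t\}$ for $t\ge 0$ (with $x,y\in M$ and $\inf\emptyset=+\infty$). The map $f$ is coarse if $\omega_f(t)<\infty$ for all $t\ge0$; solvent if for each $n\in\mathbb{N}$ there is $R>0$ such that for all $x,y\in M$, $d(x,y)\in[R,R+n]$ implies $\partial(f(x),f(y))>n$; almost uncollapsed if $\overline{\rho}_f(t)>0$ for some $t>0$. For $k\in\mathbb{N}$ and an infinite set $\mathbb{M}\subset\mathbb{N}$, $\mathcal{P}_k(\mathbb{M})$ is the set of $k$-element subsets of $\mathbb{M}$, written in increasing order $\bar n=\{n_1<\dots<n_k\}$. $\mathcal{P}_k(\mathbb{N})$ is a graph in which two distinct elements $\bar n,\bar m$ are adjacent if $n_1\le m_1\le n_2\le\dots\le n_k\le m_k$ or $m_1\le n_1\le m_2\le\dots\le m_k\le n_k$; it carries the shortest path metric. Write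 $\bar n<\bar m$ if $n_k<m_1$. For $\varepsilon,\delta>0$, a metric space $(M,d)$ has Property $\mathcal{Q}(\varepsilon,\delta)$ if for all $k\in\mathbb{N}$ and all $f:\mathcal{P}_k(\mathbb{N})\to M$ with $\omega_f(1)\le\delta$ there is an infinite $\mathbb{M}\subset\mathbb{N}$ such that $d(f(\bar n),f(\bar m))\le\varepsilon$ for all $\bar n<\bar m$ in $\mathcal{P}_k(\mathbb{M})$. $\Delta_M(\varepsilon)$ is the supremum of all $\delta>0$ such that $M$ has Property $\mathcal{Q}(\varepsilon,\delta)$ ($0$ if there is none). For a Banach space $X$ there is a constant $Q_X\ge0$ with $\Delta_X(\varepsilon)=Q_X\varepsilon$ for all $\varepsilon>0$; $X$ has Property $\mathcal{Q}$ if $Q_X>0$. *)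

theory Defs
  imports "HOL-Analysis.Analysis" "HOL-Library.Ramsey"
begin

section \<open>Moduli of maps between metric spaces\<close>

text \<open>
  Metric spaces are given by a carrier and a distance function, because the graph metric on
  k-subsets of the naturals is not the \<open>dist\<close> of a type. Here \<open>M\<close>, \<open>d\<close> describe the domain and
  \<open>e\<close> is the distance of the target. Both moduli take values in \<open>[0, \<infinity>]\<close>.
\<close>

definition omega_mod :: "'a set \<Rightarrow> ('a \<Rightarrow> 'a \<Rightarrow> real) \<Rightarrow> ('b \<Rightarrow> 'b \<Rightarrow> real) \<Rightarrow> ('a \<Rightarrow> 'b) \<Rightarrow> real \<Rightarrow> ennreal"
  where "omega_mod M d e f t = (SUP (x, y) \<in> {(x, y). x \<in> M \<and> y \<in> M \<and> d x y \<le> t}. ennreal (e (f x) (f y)))"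

definition rho_bar :: "'a set \<Rightarrow> ('a \<Rightarrow> 'a \<Rightarrow> real) \<Rightarrow> ('b \<Rightarrow> 'b \<Rightarrow> real) \<Rightarrow> ('a \<Rightarrow> 'b) \<Rightarrow> real \<Rightarrow> ennreal"
  where "rho_bar M d e f t = (INF (x, y) \<in> {(x, y). x \<in> M \<and> y \<in> M \<and> d x y = t}. ennreal (e (f x) (f y)))"

definition coarse_map :: "'a set \<Rightarrow> ('a \<Rightarrow> 'a \<Rightarrow> real) \<Rightarrow> ('b \<Rightarrow> 'b \<Rightarrow> real) \<Rightarrow> ('a \<Rightarrow> 'b) \<Rightarrow> bool"
  where "coarse_map M d e f \<longleftrightarrow> (\<forall>t\<ge>0. omega_mod M d e f t < \<infinity>)"

definition solvent_map :: "'a set \<Rightarrow> ('a \<Rightarrow> 'a \<Rightarrow> real) \<Rightarrow> ('b \<Rightarrow> 'b \<Rightarrow> real) \<Rightarrow> ('a \<Rightarrow> 'b) \<Rightarrow> bool"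
  where "solvent_map M d e f \<longleftrightarrow>
    (\<forall>n::nat. n \<ge> 1 \<longrightarrow>
      (\<exists>R>0. \<forall>x\<in>M. \<forall>y\<in>M. d x y \<in> {R..R + real n} \<longrightarrow> e (f x) (f y) > real n))"

definition almost_uncollapsed :: "'a set \<Rightarrow> ('a \<Rightarrow> 'a \<Rightarrow> real) \<Rightarrow> ('b \<Rightarrow> 'b \<Rightarrow> real) \<Rightarrow> ('a \<Rightarrow> 'b) \<Rightarrow> bool"
  where "almost_uncollapsed M d e f \<longleftrightarrow> (\<exists>t>0. rho_bar M d e f t > 0)"

section \<open>The interlacing graphs\<close>

text \<open>
  The k-element subsets of \<open>A\<close> are \<open>nsets A k\<close>. The i-th smallest element (counted from 0) of a
  finite set \<open>n\<close> is \<open>sorted_list_of_set n ! i\<close>.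
\<close>

definition interlaced :: "nat \<Rightarrow> nat set \<Rightarrow> nat set \<Rightarrow> bool"
  where "interlaced k n m \<longleftrightarrow>
    (\<forall>i<k. sorted_list_of_set n ! i \<le> sorted_list_of_set m ! i) \<and>
    (\<forall>i. Suc i < k \<longrightarrow> sorted_list_of_set m ! i \<le> sorted_list_of_set n ! Suc i)"

definition interlacing_edges :: "nat \<Rightarrow> (nat set \<times> nat set) set"
  where "interlacing_edges k =
    {(n, m). n \<in> nsets UNIV k \<and> m \<in> nsets UNIV k \<and> n \<noteq> m \<and> (interlaced k n m \<or> interlaced k m n)}"

definition interlacing_dist :: "nat \<Rightarrow> nat set \<Rightarrow> nat set \<Rightarrow> real"
  where "interlacing_dist k n m = real (LEAST j. (n, m) \<in> interlacing_edges k ^^ j)"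

text \<open>
  The graph is connected, so the \<open>LEAST\<close> above is always attained and \<open>interlacing_dist k\<close> is a
  metric on \<open>nsets UNIV k\<close>.
\<close>

lemma interlacing_edges_sym: "sym (interlacing_edges k)"
  by (auto simp: interlacing_edges_def sym_def)

lemma interlacing_shift_edge:
  assumes "sorted (x # xs)" "distinct (x # xs)" "\<forall>y\<in>set (x # xs). y < N" "k = Suc (length xs)"
  shows "(set (x # xs), set (xs @ [N])) \<in> interlacing_edges k"
proof -
  have s2: "sorted (xs @ [N])" and d2: "distinct (xs @ [N])"
    using assms by (auto simp: sorted_append less_imp_le)
  have l1: "sorted_list_of_set (set (x # xs)) = x # xs"
    and l2: "sorted_list_of_set (set (xs @ [N])) = xs @ [N]"
    using assms(1,2) s2 d2 sorted_list_of_set.idem_if_sorted_distinct by blast+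
  have step: "(x # xs) ! i \<le> (xs @ [N]) ! i" if "i < k" for i
  proof (cases "i < length xs")
    case True
    then have "(x # xs) ! i \<le> (x # xs) ! Suc i"
      using assms(1) by (intro sorted_nth_mono) auto
    with True show ?thesis by (simp add: nth_append)
  next
    case False
    with that assms(4) have "i = length xs" by simp
    moreover have "(x # xs) ! i \<in> set (x # xs)"
      using that assms(4) by (intro nth_mem) simp
    ultimately show ?thesis using assms(3) by (auto simp: nth_append less_imp_le)
  qed
  have "interlaced k (set (x # xs)) (set (xs @ [N]))"
    unfolding interlaced_def l1 l2 using step assms(4) by (auto simp: nth_append)
  moreover have "card (set (x # xs)) = k" "card (set (xs @ [N])) = k"
    using assms(2,4) d2 by (simp_all only: distinct_card) simp_all
  moreover have "set (x # xs) \<noteq> set (xs @ [N])"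
    using assms(3) by auto
  ultimately show ?thesis
    by (simp add: interlacing_edges_def nsets_def)
qed

lemma interlacing_shift_path:
  assumes "sorted (xs @ zs)" "distinct (xs @ zs)" "\<forall>y\<in>set (xs @ zs). y < N" "k = length (xs @ zs)"
  shows "(set (xs @ zs), set (zs @ [N..<N + length xs])) \<in> (interlacing_edges k)\<^sup>*"
  using assms
proof (induction xs arbitrary: zs N)
  case Nil
  then show ?case by simp
next
  case (Cons x xs)
  have "(set (x # (xs @ zs)), set ((xs @ zs) @ [N])) \<in> interlacing_edges k"
    using Cons.prems by (intro interlacing_shift_edge) auto
  moreover have "(set (xs @ (zs @ [N])), set ((zs @ [N]) @ [Suc N..<Suc N + length xs])) \<in> (interlacing_edges k)\<^sup>*"
    using Cons.prems
    by (intro Cons.IH) (auto simp: sorted_append less_imp_le less_Suc_eq)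
  moreover have "(zs @ [N]) @ [Suc N..<Suc N + length xs] = zs @ [N..<N + length (x # xs)]"
    using upt_conv_Cons[of N "N + length (x # xs)"] by (simp del: upt_Suc)
  ultimately show ?case
    by (metis append_assoc append_Cons converse_rtrancl_into_rtrancl)
qed

lemma interlacing_connected:
  assumes "n \<in> nsets UNIV k" "m \<in> nsets UNIV k"
  shows "(n, m) \<in> (interlacing_edges k)\<^sup>*"
proof -
  have fin: "finite n" "finite m" and c: "card n = k" "card m = k"
    using assms by (auto simp: nsets_def)
  obtain N where N: "\<forall>y\<in>n \<union> m. y < N"
    using fin finite_nat_set_iff_bounded by (meson finite_UnI)
  have *: "(p, {N..<N + k}) \<in> (interlacing_edges k)\<^sup>*"
    if "finite p" "card p = k" "\<forall>y\<in>p. y < N" for p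
    using interlacing_shift_path[of "sorted_list_of_set p" "[]" N k] that by simp
  have "(n, {N..<N + k}) \<in> (interlacing_edges k)\<^sup>*" "(m, {N..<N + k}) \<in> (interlacing_edges k)\<^sup>*"
    using * fin c N by auto
  then show ?thesis
    by (meson interlacing_edges_sym rtrancl_trans sym_rtrancl symD)
qed

lemma interlacing_dist_path:
  assumes "n \<in> nsets UNIV k" "m \<in> nsets UNIV k"
  obtains j where "interlacing_dist k n m = real j" "(n, m) \<in> interlacing_edges k ^^ j"
  using interlacing_connected[OF assms] LeastI_ex[of "\<lambda>j. (n, m) \<in> interlacing_edges k ^^ j"]
  by (auto simp: rtrancl_power interlacing_dist_def)

lemma interlacing_dist_le:
  assumes "(n, m) \<in> interlacing_edges k ^^ j"
  shows "interlacing_dist k n m \<le> real j"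
  using assms by (simp add: interlacing_dist_def Least_le)

lemma Metric_space_interlacing: "Metric_space (nsets UNIV k) (interlacing_dist k)"
proof
  fix n m :: "nat set"
  show "0 \<le> interlacing_dist k n m"
    by (simp add: interlacing_dist_def)
  have "(n, m) \<in> interlacing_edges k ^^ j \<longleftrightarrow> (m, n) \<in> interlacing_edges k ^^ j" for j
  proof -
    have "(a, b) \<in> interlacing_edges k ^^ j \<Longrightarrow> (b, a) \<in> interlacing_edges k ^^ j" for a b
    proof (induction j arbitrary: b)
      case (Suc j)
      then show ?case
        by (metis interlacing_edges_sym relpow_Suc_E relpow_Suc_I2 symD)
    qed auto
    then show ?thesis by blast
  qed
  then show "interlacing_dist k n m = interlacing_dist k m n"
    by (simp add: interlacing_dist_def)
next
  fix n m :: "nat set"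
  assume nm: "n \<in> nsets UNIV k" "m \<in> nsets UNIV k"
  show "interlacing_dist k n m = 0 \<longleftrightarrow> n = m"
  proof
    assume "interlacing_dist k n m = 0"
    then show "n = m" using interlacing_dist_path[OF nm] by (metis of_nat_eq_0_iff relpow_0_E)
  next
    assume "n = m"
    then show "interlacing_dist k n m = 0"
      using interlacing_dist_le[of n m 0 k] by (simp add: interlacing_dist_def)
  qed
next
  fix n m p :: "nat set"
  assume nm: "n \<in> nsets UNIV k" "m \<in> nsets UNIV k" "p \<in> nsets UNIV k"
  obtain i where i: "interlacing_dist k n m = real i" "(n, m) \<in> interlacing_edges k ^^ i"
    using interlacing_dist_path nm by blast
  obtain j where j: "interlacing_dist k m p = real j" "(m, p) \<in> interlacing_edges k ^^ j"
    using interlacing_dist_path nm by blast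
  have "(n, p) \<in> interlacing_edges k ^^ (i + j)"
    using i(2) j(2) by (auto simp: relpow_add)
  then show "interlacing_dist k n p \<le> interlacing_dist k n m + interlacing_dist k m p"
    using interlacing_dist_le i(1) j(1) by fastforce
qed

section \<open>Property Q\<close>

text \<open>
  The relation \<open>n < m\<close> on k-subsets (every element of \<open>n\<close> precedes every element of \<open>m\<close>) is
  written \<open>Max n < Min m\<close>; \<open>k \<ge> 1\<close> makes these extrema meaningful.
\<close>

definition property_Q_at :: "'a set \<Rightarrow> ('a \<Rightarrow> 'a \<Rightarrow> real) \<Rightarrow> real \<Rightarrow> real \<Rightarrow> bool"
  where "property_Q_at M d \<epsilon> \<delta> \<longleftrightarrow>
    (\<forall>k\<ge>1. \<forall>f \<in> nsets UNIV k \<rightarrow> M.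
      omega_mod (nsets UNIV k) (interlacing_dist k) d f 1 \<le> ennreal \<delta> \<longrightarrow>
      (\<exists>L::nat set. infinite L \<and>
        (\<forall>n \<in> nsets L k. \<forall>m \<in> nsets L k. Max n < Min m \<longrightarrow> d (f n) (f m) \<le> \<epsilon>)))"

definition Delta_Q :: "'a set \<Rightarrow> ('a \<Rightarrow> 'a \<Rightarrow> real) \<Rightarrow> real \<Rightarrow> ennreal"
  where "Delta_Q M d \<epsilon> = (SUP \<delta> \<in> {\<delta>. \<delta> > 0 \<and> property_Q_at M d \<epsilon> \<delta>}. ennreal \<delta>)"

text \<open>
  The constant lives in \<open>[0, \<infinity>]\<close>: for the zero space \<open>Delta_Q\<close> is constantly \<open>\<infinity>\<close>.
\<close>

definition Q_const :: "'a::banach itself \<Rightarrow> ennreal"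
  where "Q_const _ = (THE Q. \<forall>\<epsilon>>0. Delta_Q (UNIV :: 'a set) dist \<epsilon> = Q * ennreal \<epsilon>)"

definition property_Q :: "'a::banach itself \<Rightarrow> bool"
  where "property_Q X \<longleftrightarrow> Q_const X > 0"

text \<open>The defining equation of \<open>Q_const\<close> does have exactly one solution.\<close>

lemma omega_mod_le_iff:
  assumes "\<delta> \<ge> 0"
  shows "omega_mod M d e f t \<le> ennreal \<delta> \<longleftrightarrow> (\<forall>x\<in>M. \<forall>y\<in>M. d x y \<le> t \<longrightarrow> e (f x) (f y) \<le> \<delta>)"
  using assms by (auto simp: omega_mod_def SUP_le_iff ennreal_le_iff)

lemma property_Q_at_scale:
  assumes "property_Q_at (UNIV :: 'a::real_normed_vector set) dist \<epsilon> \<delta>" "c > 0" "\<delta> > 0"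
  shows "property_Q_at (UNIV :: 'a set) dist (c * \<epsilon>) (c * \<delta>)"
  unfolding property_Q_at_def
proof (intro allI ballI impI)
  fix k :: nat and f :: "nat set \<Rightarrow> 'a"
  assume k: "1 \<le> k" and f: "omega_mod (nsets UNIV k) (interlacing_dist k) dist f 1 \<le> ennreal (c * \<delta>)"
  define g where "g n = (1 / c) *\<^sub>R f n" for n
  have dg: "dist (f n) (f m) = c * dist (g n) (g m)" for n m
    using assms(2) by (simp add: g_def dist_norm flip: scaleR_diff_right)
  have "omega_mod (nsets UNIV k) (interlacing_dist k) dist g 1 \<le> ennreal \<delta>"
    using f assms(2,3) by (auto simp: omega_mod_le_iff dg)
  then obtain L :: "nat set" where "infinite L"
    "\<forall>n \<in> nsets L k. \<forall>m \<in> nsets L k. Max n < Min m \<longrightarrow> dist (g n) (g m) \<le> \<epsilon>"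
    using assms(1) k unfolding property_Q_at_def by blast
  then show "\<exists>L::nat set. infinite L \<and>
        (\<forall>n \<in> nsets L k. \<forall>m \<in> nsets L k. Max n < Min m \<longrightarrow> dist (f n) (f m) \<le> c * \<epsilon>)"
    using assms(2) by (auto simp: dg)
qed

lemma Delta_Q_scale_le:
  assumes "c > 0"
  shows "Delta_Q (UNIV :: 'a::real_normed_vector set) dist \<epsilon> * ennreal c \<le> Delta_Q (UNIV :: 'a set) dist (c * \<epsilon>)"
  unfolding Delta_Q_def SUP_mult_right_ennreal
proof (rule SUP_least)
  fix \<delta> assume "\<delta> \<in> {\<delta>. 0 < \<delta> \<and> property_Q_at (UNIV :: 'a set) dist \<epsilon> \<delta>}"
  then have "c * \<delta> \<in> {\<delta>. 0 < \<delta> \<and> property_Q_at (UNIV :: 'a set) dist (c * \<epsilon>) \<delta>}"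
    and "0 < \<delta>"
    using property_Q_at_scale assms by auto
  then have "ennreal (c * \<delta>) \<le> (SUP \<delta> \<in> {\<delta>. 0 < \<delta> \<and> property_Q_at (UNIV :: 'a set) dist (c * \<epsilon>) \<delta>}. ennreal \<delta>)"
    by (intro SUP_upper)
  then show "ennreal \<delta> * ennreal c \<le> (SUP \<delta> \<in> {\<delta>. 0 < \<delta> \<and> property_Q_at (UNIV :: 'a set) dist (c * \<epsilon>) \<delta>}. ennreal \<delta>)"
    using assms \<open>0 < \<delta>\<close> by (simp add: ennreal_mult mult.commute)
qed

lemma Delta_Q_homogeneous:
  assumes "\<epsilon> > 0"
  shows "Delta_Q (UNIV :: 'a::real_normed_vector set) dist \<epsilon> = Delta_Q (UNIV :: 'a set) dist 1 * ennreal \<epsilon>"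
proof (rule antisym)
  have "ennreal (1 / \<epsilon>) * ennreal \<epsilon> = 1"
    using assms by (simp flip: ennreal_mult)
  then have "Delta_Q (UNIV :: 'a set) dist \<epsilon> =
      Delta_Q (UNIV :: 'a set) dist \<epsilon> * ennreal (1 / \<epsilon>) * ennreal \<epsilon>"
    by (simp add: mult.assoc)
  also have "\<dots> \<le> Delta_Q (UNIV :: 'a set) dist 1 * ennreal \<epsilon>"
    using Delta_Q_scale_le[of "1 / \<epsilon>" \<epsilon>, where 'a='a] assms by (intro mult_right_mono) auto
  finally show "Delta_Q (UNIV :: 'a set) dist \<epsilon> \<le> Delta_Q (UNIV :: 'a set) dist 1 * ennreal \<epsilon>" .
  show "Delta_Q (UNIV :: 'a set) dist 1 * ennreal \<epsilon> \<le> Delta_Q (UNIV :: 'a set) dist \<epsilon>"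
    using Delta_Q_scale_le[of \<epsilon> 1, where 'a='a] assms by simp
qed

lemma Q_const_eq: "Q_const TYPE('a::banach) = Delta_Q (UNIV :: 'a set) dist 1"
  unfolding Q_const_def
proof (rule the_equality)
  show "\<forall>\<epsilon>>0. Delta_Q (UNIV :: 'a set) dist \<epsilon> = Delta_Q (UNIV :: 'a set) dist 1 * ennreal \<epsilon>"
    using Delta_Q_homogeneous by blast
next
  fix Q assume "\<forall>\<epsilon>>0. Delta_Q (UNIV :: 'a set) dist \<epsilon> = Q * ennreal \<epsilon>"
  then show "Q = Delta_Q (UNIV :: 'a set) dist 1"
    by (metis ennreal_1 mult.right_neutral zero_less_one)
qed

lemma Q_const_spec:
  "\<epsilon> > 0 \<Longrightarrow> Delta_Q (UNIV :: 'a::banach set) dist \<epsilon> = Q_const TYPE('a) * ennreal \<epsilon>"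
  by (simp only: Q_const_eq flip: Delta_Q_homogeneous)

end

theory Submission
  imports Defs
begin

text \<open>
  Failure of Property Q is self-improving. Since \<open>\<Delta>\<close> is homogeneous, a Banach space \<open>X\<close> without
  the property violates \<open>Q(1, \<delta>)\<close> for every \<open>\<delta> > 0\<close>: there are maps on interlacing graphs with
  arbitrarily short edges such that every infinite set of naturals carries a pair of subsets, one
  before the other, whose images are more than \<open>1\<close> apart. The linear structure turns such maps into
  far more rigid ones (\<open>not_property_Q_separated\<close>): for any prescribed \<open>t, s, \<eta> > 0\<close> there is a map
  with edges of length at most \<open>\<eta>\<close>, for which \<^emph>\<open>all\<close> pairs \<open>n < m\<close> have images at a distance in
  \<open>[t, t + s]\<close>, and whose values have norm at most \<open>t + s\<close>. Indeed Ramsey's theorem makes the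
  distances for \<open>n < m\<close> almost constant, a homothety moves the constant to \<open>t\<close>, and subtracting the
  value at one fixed subset placed before all the others makes the norms equal to such distances.

  Composing such a map with a map \<open>\<phi>\<close> into \<open>Y\<close> contradicts Property Q of \<open>Y\<close> as soon as the edges
  of the composition are short in comparison with the distances between the images of \<open>n < m\<close>
  (\<open>property_Q_at_close_pair\<close>).

  \<^item> Let \<open>\<phi>\<close> be coarse and solvent. Edges of length at most \<open>1\<close> become edges of length at most a
    constant \<open>C\<close>. Solvency supplies arbitrarily large \<open>N\<close> with an \<open>R\<close> such that distances in
    \<open>[R, R + N]\<close> are sent above \<open>N\<close>. Take \<open>N\<close> large in comparison with \<open>C\<close>, then \<open>t = R\<close>, \<open>s = N\<close>.
  \<^item> Let \<open>\<phi>\<close> be uniformly continuous on the unit ball and move points at distance exactly \<open>t < 1\<close>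
    at least \<open>r\<close> apart. By uniform continuity points at a distance in \<open>[t, t + s]\<close> still
    move at least \<open>r / 2\<close> apart for small \<open>s\<close>, the norm bound \<open>t + s \<le> 1\<close> keeps all values in the
    ball, and small \<open>\<eta>\<close> makes the edges of the composition as short as needed.
  \<^item> A uniformly continuous almost uncollapsed map on all of \<open>X\<close> reduces to the previous case: after
    rescaling the variable, the distance at which it is bounded below is \<open>1 / 2\<close>.
\<close>

section \<open>Increasing relabellings and consecutive subsets\<close>

lemma sorted_list_of_set_strict_mono_image:
  assumes "strict_mono (h :: nat \<Rightarrow> nat)" "finite n"
  shows "sorted_list_of_set (h ` n) = map h (sorted_list_of_set n)"
proof -
  have "sorted (map h (sorted_list_of_set n))"
    unfolding sorted_map using sorted_sorted_list_of_set
    by (rule sorted_wrt_mono_rel[rotated]) (rule monoD[OF strict_mono_mono[OF assms(1)]])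
  moreover have "distinct (map h (sorted_list_of_set n))"
    using strict_mono_imp_inj_on[OF assms(1)] by (simp add: distinct_map inj_on_def)
  ultimately have "sorted_list_of_set (set (map h (sorted_list_of_set n))) = map h (sorted_list_of_set n)"
    by (rule sorted_list_of_set.idem_if_sorted_distinct)
  then show ?thesis
    using assms(2) by simp
qed

lemma sorted_list_of_set_Un_less:
  assumes "finite (n :: nat set)" "finite m" "\<forall>x\<in>n. \<forall>y\<in>m. x < y"
  shows "sorted_list_of_set (n \<union> m) = sorted_list_of_set n @ sorted_list_of_set m"
proof -
  let ?l = "sorted_list_of_set n @ sorted_list_of_set m"
  have "sorted ?l" "distinct ?l"
    using assms by (auto simp: sorted_append less_imp_le)
  then have "sorted_list_of_set (set ?l) = ?l"
    by (rule sorted_list_of_set.idem_if_sorted_distinct)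
  then show ?thesis
    using assms by simp
qed

lemma Max_less_Min_iff:
  fixes n m :: "nat set"
  assumes "n \<in> nsets A k" "m \<in> nsets B k" "k \<ge> 1"
  shows "Max n < Min m \<longleftrightarrow> (\<forall>x\<in>n. \<forall>y\<in>m. x < y)"
proof -
  have "finite n" "n \<noteq> {}" "finite m" "m \<noteq> {}"
    using assms by (auto simp: nsets_def)
  then show ?thesis
    by (auto simp: Max_less_iff Min_gr_iff)
qed

lemma nsets_strict_mono_image:
  assumes "strict_mono (h :: nat \<Rightarrow> nat)" "n \<in> nsets UNIV k"
  shows "h ` n \<in> nsets (range h) k"
  using assms by (auto simp: nsets_def card_image strict_mono_imp_inj_on inj_on_subset)

lemma interlaced_strict_mono_image:
  assumes "strict_mono (h :: nat \<Rightarrow> nat)" "n \<in> nsets UNIV k" "m \<in> nsets UNIV k" "interlaced k n m"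
  shows "interlaced k (h ` n) (h ` m)"
  using assms strict_mono_less_eq[OF assms(1)]
  by (auto simp: interlaced_def nsets_def sorted_list_of_set_strict_mono_image)

lemma interlacing_edges_strict_mono_image:
  assumes "strict_mono (h :: nat \<Rightarrow> nat)" "(n, m) \<in> interlacing_edges k"
  shows "(h ` n, h ` m) \<in> interlacing_edges k"
proof -
  have nm: "n \<in> nsets UNIV k" "m \<in> nsets UNIV k" "n \<noteq> m" "interlaced k n m \<or> interlaced k m n"
    using assms(2) by (simp_all add: interlacing_edges_def)
  have "h ` n \<in> nsets UNIV k" "h ` m \<in> nsets UNIV k"
    using nm(1,2)[THEN nsets_strict_mono_image[OF assms(1)]] by (simp_all add: nsets_def)
  moreover have "h ` n \<noteq> h ` m"
    using nm(3) inj_image_eq_iff[OF strict_mono_imp_inj_on[OF assms(1)]] by simp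
  moreover have "interlaced k (h ` n) (h ` m) \<or> interlaced k (h ` m) (h ` n)"
    using nm interlaced_strict_mono_image[OF assms(1)] by blast
  ultimately show ?thesis by (simp add: interlacing_edges_def)
qed

section \<open>Lipschitz estimates on interlacing graphs\<close>

lemma interlacing_dist_le_1_iff:
  assumes "n \<in> nsets UNIV k" "m \<in> nsets UNIV k"
  shows "interlacing_dist k n m \<le> 1 \<longleftrightarrow> n = m \<or> (n, m) \<in> interlacing_edges k"
proof
  assume le: "interlacing_dist k n m \<le> 1"
  obtain j where j: "interlacing_dist k n m = real j" "(n, m) \<in> interlacing_edges k ^^ j"
    using interlacing_dist_path[OF assms] by blast
  with le have "j = 0 \<or> j = 1" by auto
  with j(2) show "n = m \<or> (n, m) \<in> interlacing_edges k" by auto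
next
  assume "n = m \<or> (n, m) \<in> interlacing_edges k"
  then show "interlacing_dist k n m \<le> 1"
    using interlacing_dist_le[of n m 0 k] interlacing_dist_le[of n m 1 k] by auto
qed

lemma omega_mod_interlacing_le_iff:
  assumes "\<delta> \<ge> 0"
  shows "omega_mod (nsets UNIV k) (interlacing_dist k) dist f 1 \<le> ennreal \<delta> \<longleftrightarrow>
    (\<forall>(n, m) \<in> interlacing_edges k. dist (f n) (f m :: 'a :: metric_space) \<le> \<delta>)"
  (is "?L \<longleftrightarrow> ?R")
proof
  assume ?L
  show ?R
  proof clarify
    fix n m assume e: "(n, m) \<in> interlacing_edges k"
    then have "n \<in> nsets UNIV k" "m \<in> nsets UNIV k" by (auto simp: interlacing_edges_def)
    with e \<open>?L\<close> assms show "dist (f n) (f m) \<le> \<delta>"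
      by (auto simp: omega_mod_le_iff interlacing_dist_le_1_iff)
  qed
next
  assume ?R
  then show ?L
    using assms by (auto simp: omega_mod_le_iff interlacing_dist_le_1_iff)
qed

text \<open>
  One edge replaces the smallest element of a subset by a new largest one. Doing this \<open>length xs\<close>
  times exchanges the block \<open>xs\<close> for the block \<open>ys\<close>; the block \<open>zs\<close>, common to both ends of the
  path, is what makes the induction go through.
\<close>

lemma interlacing_path_bound:
  fixes f :: "nat set \<Rightarrow> 'a :: metric_space"
  assumes "\<forall>(n, m) \<in> interlacing_edges k. dist (f n) (f m) \<le> \<delta>"
    and "sorted (xs @ zs @ ys)" "distinct (xs @ zs @ ys)"
    and "length ys = length xs" "k = length (xs @ zs)"
  shows "dist (f (set (xs @ zs))) (f (set (zs @ ys))) \<le> real (length xs) * \<delta>"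
  using assms(2-)
proof (induction xs arbitrary: zs ys)
  case Nil
  then show ?case by simp
next
  case (Cons x xs)
  then obtain y ys' where ys: "ys = y # ys'" by (cases ys) auto
  have "(set (x # (xs @ zs)), set ((xs @ zs) @ [y])) \<in> interlacing_edges k"
  proof (rule interlacing_shift_edge)
    have "\<forall>v\<in>set (x # xs @ zs). v \<le> y \<and> v \<noteq> y"
      using Cons.prems(1,2) ys by (auto simp: sorted_append)
    then show "\<forall>v\<in>set (x # xs @ zs). v < y"
      by (simp add: less_le)
  qed (use Cons.prems in \<open>auto simp: sorted_append\<close>)
  then have "dist (f (set (x # xs @ zs))) (f (set (xs @ zs @ [y]))) \<le> \<delta>"
    using assms(1) by auto
  moreover have "dist (f (set (xs @ zs @ [y]))) (f (set ((zs @ [y]) @ ys'))) \<le> real (length xs) * \<delta>"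
    using Cons.prems ys by (intro Cons.IH) auto
  moreover have "set ((zs @ [y]) @ ys') = set (zs @ ys)"
    using ys by simp
  ultimately show ?case
    using dist_triangle[of "f (set (x # xs @ zs))" "f (set (zs @ ys))" "f (set (xs @ zs @ [y]))"]
    by (simp add: algebra_simps)
qed

text \<open>
  This bound, uniform in \<open>n\<close> and \<open>m\<close>, allows distances to be coloured with finitely many colours.
\<close>

lemma dist_le_of_less:
  fixes f :: "nat set \<Rightarrow> 'a :: metric_space"
  assumes "\<forall>(n, m) \<in> interlacing_edges k. dist (f n) (f m) \<le> \<delta>"
    and "n \<in> nsets UNIV k" "m \<in> nsets UNIV k" "\<forall>x\<in>n. \<forall>y\<in>m. x < y"
  shows "dist (f n) (f m) \<le> real k * \<delta>"
proof -
  have fin: "finite n" "finite m" "card n = k" "card m = k"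
    using assms(2,3) by (auto simp: nsets_def)
  let ?n = "sorted_list_of_set n" and ?m = "sorted_list_of_set m"
  have "sorted (?n @ [] @ ?m)" "distinct (?n @ [] @ ?m)"
    using fin assms(4) by (auto simp: sorted_append less_imp_le)
  then have "dist (f (set (?n @ []))) (f (set ([] @ ?m))) \<le> real (length ?n) * \<delta>"
    using fin by (intro interlacing_path_bound[OF assms(1)]) simp_all
  then show ?thesis
    using fin by simp
qed

section \<open>Failure of Property Q yields separated maps\<close>

text \<open>
  A pair of \<open>k\<close>-subsets, the first one before the second, is the same thing as a subset with \<open>2 * k\<close>
  elements cut in the middle, so that Ramsey's theorem for \<open>2 * k\<close>-subsets applies to such pairs.
\<close>

lemma Ramsey_pairs_less:
  fixes c :: "nat set \<Rightarrow> nat set \<Rightarrow> nat"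
  assumes "\<And>n m. n \<in> nsets UNIV k \<Longrightarrow> m \<in> nsets UNIV k \<Longrightarrow> \<forall>x\<in>n. \<forall>y\<in>m. x < y \<Longrightarrow> c n m < N"
  obtains L :: "nat set" and j where "infinite L"
    "\<And>n m. n \<in> nsets L k \<Longrightarrow> m \<in> nsets L k \<Longrightarrow> \<forall>x\<in>n. \<forall>y\<in>m. x < y \<Longrightarrow> c n m = j"
proof -
  define lo where "lo S = set (take k (sorted_list_of_set S))" for S :: "nat set"
  define hi where "hi S = set (drop k (sorted_list_of_set S))" for S :: "nat set"
  have bound: "c (lo S) (hi S) < N" if "finite S" "card S = 2 * k" for S
  proof (rule assms)
    let ?l = "sorted_list_of_set S"
    have "sorted (take k ?l @ drop k ?l)" "distinct (take k ?l @ drop k ?l)"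
      by (simp_all only: append_take_drop_id sorted_sorted_list_of_set distinct_sorted_list_of_set)
    then have "\<forall>x\<in>lo S. \<forall>y\<in>hi S. x \<le> y" "lo S \<inter> hi S = {}"
      unfolding sorted_append distinct_append lo_def hi_def by simp_all
    then show "\<forall>x\<in>lo S. \<forall>y\<in>hi S. x < y"
      by (metis disjoint_iff le_neq_implies_less)
    show "lo S \<in> nsets UNIV k" "hi S \<in> nsets UNIV k"
      using that by (auto simp: lo_def hi_def nsets_def distinct_card)
  qed
  have "\<forall>S. S \<subseteq> UNIV \<and> finite S \<and> card S = 2 * k \<longrightarrow> c (lo S) (hi S) < N"
    using bound by blast
  then obtain L j where L: "infinite L"
    "\<forall>S. S \<subseteq> L \<and> finite S \<and> card S = 2 * k \<longrightarrow> c (lo S) (hi S) = j"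
    using Ramsey[of "UNIV :: nat set" "2 * k" "\<lambda>S. c (lo S) (hi S)" N] by auto
  show thesis
  proof (rule that[OF L(1)])
    fix n m assume nm: "n \<in> nsets L k" "m \<in> nsets L k" "\<forall>x\<in>n. \<forall>y\<in>m. x < y"
    then have fin: "finite n" "finite m" "card n = k" "card m = k" "n \<union> m \<subseteq> L"
      by (auto simp: nsets_def)
    have "n \<inter> m = {}" using nm(3) by blast
    then have "card (n \<union> m) = 2 * k"
      using fin by (simp add: card_Un_disjoint)
    moreover have "lo (n \<union> m) = n" "hi (n \<union> m) = m"
      using fin nm(3) by (simp_all add: lo_def hi_def sorted_list_of_set_Un_less)
    ultimately show "c n m = j"
      using L(2) fin by (metis finite_UnI)
  qed
qed

lemma property_Q_iff:
  "property_Q TYPE('a::banach) \<longleftrightarrow> (\<exists>\<delta>>0. property_Q_at (UNIV :: 'a set) dist 1 \<delta>)"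
  by (auto simp: property_Q_def Q_const_eq Delta_Q_def less_SUP_iff)

text \<open>
  Starting from a map \<open>g\<close> that violates \<open>Q(1, \<eta> / t)\<close>, Ramsey's theorem confines the distances
  for \<open>n < m\<close> to an interval \<open>[b, b + s / t]\<close> with \<open>b \<ge> 1\<close>. Scaling by \<open>t / b \<le> t\<close> takes this
  interval into \<open>[t, t + s]\<close> and the edge length \<open>\<eta> / t\<close> to at most \<open>\<eta>\<close>. That the violation concerns
  \<^emph>\<open>every\<close> infinite set is what gives \<open>b \<ge> 1\<close> on the homogeneous set found by Ramsey's theorem.
\<close>

lemma not_property_Q_separated:
  fixes t s \<eta> :: real
  assumes "\<not> property_Q TYPE('x::banach)" and "t > 0" "s > 0" "\<eta> > 0"
  obtains k :: nat and f :: "nat set \<Rightarrow> 'x::banach"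
  where "k \<ge> 1"
    and "\<forall>(n, m) \<in> interlacing_edges k. dist (f n) (f m) \<le> \<eta>"
    and "\<And>n m. n \<in> nsets UNIV k \<Longrightarrow> m \<in> nsets UNIV k \<Longrightarrow> Max n < Min m \<Longrightarrow> dist (f n) (f m) \<in> {t..t + s}"
    and "\<And>n. n \<in> nsets UNIV k \<Longrightarrow> norm (f n) \<le> t + s"
proof -
  have "\<not> property_Q_at (UNIV :: 'x set) dist 1 (\<eta> / t)"
    using assms by (auto simp: property_Q_iff)
  then obtain k and g :: "nat set \<Rightarrow> 'x" where k: "k \<ge> 1"
    and g0: "omega_mod (nsets UNIV k) (interlacing_dist k) dist g 1 \<le> ennreal (\<eta> / t)"
    and no: "\<not> (\<exists>L :: nat set. infinite L \<and>
      (\<forall>n\<in>nsets L k. \<forall>m\<in>nsets L k. Max n < Min m \<longrightarrow> dist (g n) (g m) \<le> 1))"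
    unfolding property_Q_at_def 
    by (unfold not_all not_imp ball_simps(10)) (elim exE conjE bexE, rule)
  have far: "\<exists>n\<in>nsets L k. \<exists>m\<in>nsets L k. Max n < Min m \<and> 1 < dist (g n) (g m)"
    if "infinite L" for L
    using no that by (meson not_le)
  have g: "\<forall>(n, m) \<in> interlacing_edges k. dist (g n) (g m) \<le> \<eta> / t"
    using g0 assms omega_mod_interlacing_le_iff[of "\<eta> / t" k g] by simp
  \<comment> \<open>Rounding up after subtracting \<open>1\<close> reserves colour \<open>0\<close> for the distances up to \<open>1\<close>.\<close>
  define c where "c n m = nat \<lceil>(dist (g n) (g m) - 1) * t / s\<rceil>" for n m
  have cb: "c n m < Suc (nat \<lceil>(real k * (\<eta> / t) - 1) * t / s\<rceil>)"
    if "n \<in> nsets UNIV k" "m \<in> nsets UNIV k" "\<forall>x\<in>n. \<forall>y\<in>m. x < y" for n m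
    unfolding c_def less_Suc_eq_le using dist_le_of_less[OF g that] assms
    by (intro nat_mono ceiling_mono divide_right_mono mult_right_mono) auto
  obtain L j where L: "infinite L"
    and cj: "\<And>n m. n \<in> nsets L k \<Longrightarrow> m \<in> nsets L k \<Longrightarrow> \<forall>x\<in>n. \<forall>y\<in>m. x < y \<Longrightarrow> c n m = j"
    by (rule Ramsey_pairs_less[of k c, OF cb]) (assumption | rule that)+
  obtain n m where nm: "n \<in> nsets L k" "m \<in> nsets L k" "Max n < Min m" "1 < dist (g n) (g m)"
    using far[OF L] by blast
  have "c n m = j"
    using nm cj Max_less_Min_iff[OF nm(1,2) k] by blast
  moreover have "0 < (dist (g n) (g m) - 1) * t / s"
    using nm(4) assms by simp
  ultimately have j: "j \<ge> 1"
    unfolding c_def by linarith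
  define b where "b = 1 + (real j - 1) * s / t"
  have b: "b \<ge> 1"
    using j assms by (simp add: b_def)
  have near: "t / b * dist (g n) (g m) \<in> {t..t + s}"
    if "n \<in> nsets L k" "m \<in> nsets L k" "\<forall>x\<in>n. \<forall>y\<in>m. x < y" for n m
  proof -
    let ?u = "(dist (g n) (g m) - 1) * t / s"
    have "\<lceil>?u\<rceil> = int j"
      using cj[OF that] j unfolding c_def by simp
    then have "real j - 1 < ?u" "?u \<le> real j"
      by linarith+
    then have "b \<le> dist (g n) (g m)" "dist (g n) (g m) \<le> b + s / t"
      using assms by (simp_all add: b_def field_simps)
    then have "t / b * b \<le> t / b * dist (g n) (g m)" "t / b * dist (g n) (g m) \<le> t / b * (b + s / t)"
      using assms b by (intro mult_left_mono; simp)+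
    moreover have "t / b * b = t" "t / b * (b + s / t) = t + s / b" "s / b \<le> s"
      using assms b by (simp_all add: field_simps)
    ultimately show ?thesis by simp
  qed
  \<comment> \<open>The first \<open>k\<close> elements of \<open>L\<close> form the base point \<open>p\<close>; the others serve as the new labels.\<close>
  define h where "h i = enumerate L (i + k)" for i
  have h: "strict_mono h" "range h \<subseteq> L"
    using strict_mono_enumerate[OF L] enumerate_in_set[OF L] by (auto simp: h_def strict_mono_def)
  define p where "p = enumerate L ` {..<k}"
  have p: "p \<in> nsets L k"
    using strict_mono_enumerate[OF L] enumerate_in_set[OF L]
    by (auto simp: p_def nsets_def card_image strict_mono_imp_inj_on inj_on_subset)
  have ph: "\<forall>x\<in>p. \<forall>y\<in>h ` n. x < y" for n
    using strict_mono_less[OF strict_mono_enumerate[OF L]] by (auto simp: p_def h_def)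
  have hL: "h ` n \<in> nsets L k" if "n \<in> nsets UNIV k" for n
    using nsets_strict_mono_image[OF h(1) that] h(2) by (auto simp: nsets_def)
  define f where "f n = (t / b) *\<^sub>R (g (h ` n) - g p)" for n
  have df: "dist (f n) (f m) = t / b * dist (g (h ` n)) (g (h ` m))" for n m
    using assms b by (simp add: f_def dist_norm flip: scaleR_diff_right)
  show thesis
  proof (rule that[OF k])
    show "\<forall>(n, m) \<in> interlacing_edges k. dist (f n) (f m) \<le> \<eta>"
    proof clarify
      fix n m assume "(n, m) \<in> interlacing_edges k"
      then have "dist (g (h ` n)) (g (h ` m)) \<le> \<eta> / t"
        using g interlacing_edges_strict_mono_image[OF h(1)] by fastforce
      then have "dist (f n) (f m) \<le> t / b * (\<eta> / t)"
        unfolding df using assms b by (intro mult_left_mono) auto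
      also have "\<dots> = \<eta> / b" using assms by simp
      also have "\<dots> \<le> \<eta>" using assms b by (simp add: field_simps)
      finally show "dist (f n) (f m) \<le> \<eta>" .
    qed
    show "dist (f n) (f m) \<in> {t..t + s}"
      if "n \<in> nsets UNIV k" "m \<in> nsets UNIV k" "Max n < Min m" for n m
      unfolding df using that hL Max_less_Min_iff[OF that(1,2) k] strict_mono_less[OF h(1)]
      by (intro near) auto
    show "norm (f n) \<le> t + s" if "n \<in> nsets UNIV k" for n
    proof -
      have "norm (f n) = t / b * dist (g p) (g (h ` n))"
        using assms b by (simp add: f_def dist_norm norm_minus_commute)
      then show ?thesis
        using near[OF p hL[OF that] ph] by simp
    qed
  qed
qed

section \<open>Transfer of Property Q from the target to the domain\<close>

lemma property_Q_at_close_pair: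
  fixes f :: "nat set \<Rightarrow> 'y::metric_space"
  assumes "property_Q_at (UNIV :: 'y set) dist \<epsilon> \<delta>" "\<delta> > 0" "k \<ge> 1"
    and "\<forall>(n, m) \<in> interlacing_edges k. dist (f n) (f m) \<le> \<delta>"
  obtains n m where "n \<in> nsets UNIV k" "m \<in> nsets UNIV k" "Max n < Min m" "dist (f n) (f m) \<le> \<epsilon>"
proof -
  have "omega_mod (nsets UNIV k) (interlacing_dist k) dist f 1 \<le> ennreal \<delta>"
    using assms by (simp add: omega_mod_interlacing_le_iff)
  then obtain L :: "nat set" where L: "infinite L"
    "\<forall>n \<in> nsets L k. \<forall>m \<in> nsets L k. Max n < Min m \<longrightarrow> dist (f n) (f m) \<le> \<epsilon>"
    using assms(1,3) unfolding property_Q_at_def by blast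
  have e: "strict_mono (enumerate L)" "range (enumerate L) \<subseteq> L"
    using strict_mono_enumerate[OF L(1)] enumerate_in_set[OF L(1)] by auto
  define n where "n = enumerate L ` {..<k}"
  define m where "m = enumerate L ` {k..<2 * k}"
  have "{..<k} \<in> nsets UNIV k" "{k..<2 * k} \<in> nsets UNIV k"
    by (auto simp: nsets_def)
  then have nm: "n \<in> nsets L k" "m \<in> nsets L k"
    using nsets_strict_mono_image[OF e(1)] e(2) unfolding n_def m_def nsets_def by blast+
  moreover have "Max n < Min m"
    unfolding Max_less_Min_iff[OF nm assms(3)] using strict_mono_less[OF e(1)]
    by (auto simp: n_def m_def)
  ultimately show thesis
    using L(2) by (intro that[of n m]) (auto simp: nsets_def)
qed

lemma property_Q_of_coarse_solvent:
  fixes f :: "'x::banach \<Rightarrow> 'y::banach"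
  assumes Y: "property_Q TYPE('y)"
    and coarse: "coarse_map UNIV dist dist f" and solvent: "solvent_map UNIV dist dist f"
  shows "property_Q TYPE('x)"
proof (rule ccontr)
  assume nX: "\<not> property_Q TYPE('x)"
  have "omega_mod UNIV dist dist f 1 < \<infinity>"
    using coarse by (simp add: coarse_map_def)
  then obtain C where C: "0 \<le> C" "omega_mod UNIV dist dist f 1 = ennreal C"
    by (cases "omega_mod UNIV dist dist f 1") auto
  have fC: "dist (f x) (f y) \<le> C + 1" if "dist x y \<le> 1" for x y
    using omega_mod_le_iff[of C UNIV dist dist f 1] C that by fastforce
  obtain \<delta> where d: "\<delta> > 0" "property_Q_at (UNIV :: 'y set) dist 1 \<delta>"
    using Y by (auto simp: property_Q_iff)
  have Q: "property_Q_at (UNIV :: 'y set) dist ((C + 1) / \<delta>) (C + 1)"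
    using property_Q_at_scale[OF d(2), of "(C + 1) / \<delta>"] d(1) C by simp
  define N where "N = nat \<lceil>(C + 1) / \<delta>\<rceil>"
  have N: "(C + 1) / \<delta> \<le> real N" "N \<ge> 1" "real N > 0"
    using C(1) d(1) by (auto simp: N_def Suc_le_eq)
  obtain R where R: "R > 0" "\<And>x y. dist x y \<in> {R..R + real N} \<Longrightarrow> dist (f x) (f y) > real N"
    using solvent N(2) unfolding solvent_map_def by blast
  obtain k and g :: "nat set \<Rightarrow> 'x" where k: "k \<ge> 1"
    and g: "\<forall>(n, m) \<in> interlacing_edges k. dist (g n) (g m) \<le> 1"
    and sep: "\<And>n m. n \<in> nsets UNIV k \<Longrightarrow> m \<in> nsets UNIV k \<Longrightarrow> Max n < Min m
      \<Longrightarrow> dist (g n) (g m) \<in> {R..R + real N}"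
    by (rule not_property_Q_separated[OF nX R(1) N(3) zero_less_one]) (rule that)
  have fg: "\<forall>(n, m) \<in> interlacing_edges k. dist (f (g n)) (f (g m)) \<le> C + 1"
    using g fC by fastforce
  obtain n m where "n \<in> nsets UNIV k" "m \<in> nsets UNIV k" "Max n < Min m"
    "dist (f (g n)) (f (g m)) \<le> (C + 1) / \<delta>"
    using property_Q_at_close_pair[OF Q _ k, of "\<lambda>n. f (g n)"] fg C by auto
  then show False
    using R(2)[OF sep] N(1) by fastforce
qed

lemma rho_bar_pos_iff:
  "rho_bar M d e f t > 0 \<longleftrightarrow> (\<exists>r>0. \<forall>x\<in>M. \<forall>y\<in>M. d x y = t \<longrightarrow> r \<le> e (f x) (f y))"
  (is "?L \<longleftrightarrow> ?R")
proof
  assume ?L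
  then obtain r where r: "0 < r" "r < rho_bar M d e f t"
    using dense by blast
  then obtain q where q: "r = ennreal q" "q > 0"
    by (cases r) (auto simp: ennreal_less_zero_iff top.not_eq_extremum)
  have "q \<le> e (f x) (f y)" if "x \<in> M" "y \<in> M" "d x y = t" for x y
  proof -
    have "rho_bar M d e f t \<le> ennreal (e (f x) (f y))"
      unfolding rho_bar_def using that by (intro INF_lower2[of "(x, y)"]) auto
    with r q have "ennreal q < ennreal (e (f x) (f y))" by simp
    then show ?thesis using q ennreal_less_iff by (simp add: less_imp_le)
  qed
  with q show ?R by blast
next
  assume ?R
  then obtain r where r: "r > 0" "\<forall>x\<in>M. \<forall>y\<in>M. d x y = t \<longrightarrow> r \<le> e (f x) (f y)" by blast
  then have "ennreal r \<le> rho_bar M d e f t"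
    unfolding rho_bar_def by (intro INF_greatest) (auto intro: ennreal_leI)
  then show ?L
    using r(1) by (metis ennreal_less_zero_iff less_le_trans)
qed

text \<open>
  Subtracting the base point in \<open>not_property_Q_separated\<close> is needed here, because \<open>\<phi>\<close> is only
  controlled on the unit ball, and \<open>t < 1\<close> leaves room for an \<open>s > 0\<close> with \<open>t + s \<le> 1\<close>.
\<close>

lemma property_Q_of_uniformly_continuous_ball:
  fixes \<phi> :: "'x::banach \<Rightarrow> 'y::banach"
  assumes Y: "property_Q TYPE('y)"
    and uc: "uniformly_continuous_on (cball 0 1) \<phi>"
    and t: "0 < t" "t < 1" and rho: "rho_bar (cball 0 1) dist dist \<phi> t > 0"
  shows "property_Q TYPE('x)"
proof (rule ccontr)
  assume nX: "\<not> property_Q TYPE('x)"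
  obtain r where r: "r > 0"
    "\<And>x y. x \<in> cball 0 1 \<Longrightarrow> y \<in> cball 0 1 \<Longrightarrow> dist x y = t \<Longrightarrow> r \<le> dist (\<phi> x) (\<phi> y)"
    using rho unfolding rho_bar_pos_iff by blast
  obtain s0 where s0: "s0 > 0"
    "\<And>x y. x \<in> cball 0 1 \<Longrightarrow> y \<in> cball 0 1 \<Longrightarrow> dist x y < s0 \<Longrightarrow> dist (\<phi> x) (\<phi> y) < r / 2"
    using uc r(1) unfolding uniformly_continuous_on_def by (metis dist_commute half_gt_zero)
  define s where "s = min (s0 / 2) (1 - t)"
  have s: "0 < s" "s < s0" "t + s \<le> 1"
    using s0(1) t by (auto simp: s_def)
  \<comment> \<open>The point \<open>z\<close> at distance exactly \<open>t\<close> from \<open>x\<close> on the segment from \<open>x\<close> to \<open>y\<close> stays in the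
    ball by convexity and is within \<open>s\<close> of \<open>y\<close>.\<close>
  have apart: "r / 2 < dist (\<phi> x) (\<phi> y)"
    if xy: "x \<in> cball 0 1" "y \<in> cball 0 1" "dist x y \<in> {t..t + s}" for x y
  proof -
    define u where "u = t / dist x y"
    have u: "0 \<le> u" "u \<le> 1" "u * dist x y = t"
      using xy(3) t by (auto simp: u_def divide_le_eq_1)
    define z where "z = (1 - u) *\<^sub>R x + u *\<^sub>R y"
    have z: "z \<in> cball 0 1"
      unfolding z_def using xy u by (intro convexD[OF convex_cball]) auto
    have xz: "x - z = u *\<^sub>R (x - y)" and zy: "z - y = (1 - u) *\<^sub>R (x - y)"
      by (simp_all add: z_def algebra_simps)
    have "dist x z = t" "dist z y = dist x y - t"
      using u unfolding dist_norm xz zy by (simp_all add: left_diff_distrib)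
    then have "dist x z = t" "dist z y < s0"
      using xy(3) s(2) by simp_all
    then have "r \<le> dist (\<phi> x) (\<phi> z)" "dist (\<phi> z) (\<phi> y) < r / 2"
      using r(2)[OF xy(1) z] s0(2)[OF z xy(2)] by simp_all
    then show ?thesis
      using dist_triangle[of "\<phi> x" "\<phi> z" "\<phi> y"] by (simp add: dist_commute)
  qed
  obtain \<delta>0 where d0: "\<delta>0 > 0" "property_Q_at (UNIV :: 'y set) dist 1 \<delta>0"
    using Y by (auto simp: property_Q_iff)
  define \<delta> where "\<delta> = r / 2 * \<delta>0"
  have d: "\<delta> > 0" and Q: "property_Q_at (UNIV :: 'y set) dist (r / 2) \<delta>"
    using property_Q_at_scale[OF d0(2), of "r / 2"] d0(1) r(1) by (auto simp: \<delta>_def)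
  obtain \<eta> where eta: "\<eta> > 0"
    "\<And>x y. x \<in> cball 0 1 \<Longrightarrow> y \<in> cball 0 1 \<Longrightarrow> dist x y < \<eta> \<Longrightarrow> dist (\<phi> x) (\<phi> y) < \<delta>"
    using uc d unfolding uniformly_continuous_on_def by (metis dist_commute)
  obtain k and g :: "nat set \<Rightarrow> 'x" where k: "k \<ge> 1"
    and g: "\<forall>(n, m) \<in> interlacing_edges k. dist (g n) (g m) \<le> \<eta> / 2"
    and sep: "\<And>n m. n \<in> nsets UNIV k \<Longrightarrow> m \<in> nsets UNIV k \<Longrightarrow> Max n < Min m
      \<Longrightarrow> dist (g n) (g m) \<in> {t..t + s}"
    and bd: "\<And>n. n \<in> nsets UNIV k \<Longrightarrow> norm (g n) \<le> t + s"
    using not_property_Q_separated[OF nX t(1) s(1), of "\<eta> / 2"] eta(1) by auto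
  have ball: "g n \<in> cball 0 1" if "n \<in> nsets UNIV k" for n
    using bd[OF that] s(3) by simp
  have fg: "\<forall>(n, m) \<in> interlacing_edges k. dist (\<phi> (g n)) (\<phi> (g m)) \<le> \<delta>"
  proof clarify
    fix n m assume e: "(n, m) \<in> interlacing_edges k"
    then have "n \<in> nsets UNIV k" "m \<in> nsets UNIV k"
      by (simp_all add: interlacing_edges_def)
    then have "g n \<in> cball 0 1" "g m \<in> cball 0 1"
      by (blast intro: ball)+
    moreover have "dist (g n) (g m) < \<eta>"
      using g e eta(1) by fastforce
    ultimately show "dist (\<phi> (g n)) (\<phi> (g m)) \<le> \<delta>"
      using eta(2) less_imp_le by blast
  qed
  obtain n m where "n \<in> nsets UNIV k" "m \<in> nsets UNIV k" "Max n < Min m"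
    "dist (\<phi> (g n)) (\<phi> (g m)) \<le> r / 2"
    using property_Q_at_close_pair[OF Q d k fg] by blast
  then show False
    using apart[OF ball ball sep] by fastforce
qed

lemma property_Q_of_almost_uncollapsed:
  fixes f :: "'x::banach \<Rightarrow> 'y::banach"
  assumes Y: "property_Q TYPE('y)"
    and uc: "uniformly_continuous_on UNIV f" and au: "almost_uncollapsed UNIV dist dist f"
  shows "property_Q TYPE('x)"
proof -
  obtain t r where t: "t > 0" and r: "r > 0" "\<And>x y. dist x y = t \<Longrightarrow> r \<le> dist (f x) (f y)"
    using au by (auto simp: almost_uncollapsed_def rho_bar_pos_iff)
  \<comment> \<open>The factor \<open>2 * t\<close> turns distance \<open>1 / 2\<close>, which lies in \<open>(0, 1)\<close>, into \<open>t\<close>.\<close>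
  define \<phi> where "\<phi> x = f ((2 * t) *\<^sub>R x)" for x
  have uc': "uniformly_continuous_on S f" for S
    using uc unfolding uniformly_continuous_on_def by (meson UNIV_I)
  have "uniformly_continuous_on (cball 0 1) (\<lambda>x :: 'x. (2 * t) *\<^sub>R x)"
    by (intro bounded_linear.uniformly_continuous_on[OF bounded_linear_scaleR_right]
        uniformly_continuous_on_id)
  then have "uniformly_continuous_on (cball 0 1) \<phi>"
    unfolding \<phi>_def
    using uniformly_continuous_on_compose[of "cball 0 1" "\<lambda>x. (2 * t) *\<^sub>R x" f]
      uc' by blast
  moreover have "dist ((2 * t) *\<^sub>R x) ((2 * t) *\<^sub>R y) = t" if "dist x y = 1 / 2" for x y :: 'x
    using that t by (simp add: dist_norm flip: scaleR_diff_right)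
  then have "rho_bar (cball 0 1) dist dist \<phi> (1 / 2) > 0"
    unfolding rho_bar_pos_iff \<phi>_def using r by blast
  ultimately show ?thesis
    using property_Q_of_uniformly_continuous_ball[OF Y, of \<phi> "1 / 2"] by simp
qed

theorem theorem4p1:
  assumes "property_Q TYPE('y::banach)"
  shows
    "((\<exists>f :: 'x::banach \<Rightarrow> 'y. coarse_map UNIV dist dist f \<and> solvent_map UNIV dist dist f)
      \<or> (\<exists>\<phi> :: 'x \<Rightarrow> 'y. uniformly_continuous_on (cball 0 1) \<phi> \<and>
            (\<exists>t\<in>{0<..<1}. rho_bar (cball 0 1) dist dist \<phi> t > 0))
      \<longrightarrow> property_Q TYPE('x))
    \<and> ((\<exists>f :: 'x \<Rightarrow> 'y. uniformly_continuous_on UNIV f \<and> almost_uncollapsed UNIV dist dist f)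
      \<longrightarrow> property_Q TYPE('x))"
  using property_Q_of_coarse_solvent[OF assms] property_Q_of_uniformly_continuous_ball[OF assms]
    property_Q_of_almost_uncollapsed[OF assms]
  by (auto simp del: split_paired_Ex)

end
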